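(* Let $f:Q\to\mathbb{R}$ be Lipschitz continuous with constant $M_f>0$ and $\gamma$-quasar convex with center $x_*$, $\gamma\in(0,1]$, and let $g:Q\to\mathbb{R}$ be convex and Lipschitz continuous with constant $M_g>0$, where $x_*$ is a solution of $\min\{f(x): x\in Q,\ g(x)\le 0\}$. Let $\Theta_0>0$ satisfy $\sup_{x,y\in Q}V(y,x)\le\Theta_0^2$, let $\varepsilon>0$ and let $x_0\in Q$ be a starting point. Put $M=\max\{M_f,M_g\}$ and $h=\frac{\gamma\varepsilon}{M^2}$. Consider the following algorithm. For $k=0,1,2,\dots$: - if $g(x_k)\le\varepsilon$ (productive step), set $x_{k+1}=\operatorname{Mirr}_{x_k}(h\nabla f(x_k))$; - if $g(x_k)>\varepsilon$ (non-productive step), set $x_{k+1}=\operatorname{Mirr}_{x_k}(h\nabla g(x_k))$. The algorithm stops after the first number $k$ of performed iterations (indexed $0,\dots,k-1$) for which $$k\ \ge\ \frac{2\Theta_0^2M^2}{\gamma^2\varepsilon^2}\Big(1+\frac1\gamma\Big)^2.$$ Let $I$ be the set of indices of productive steps among $0,\dots,k-1$. Then $I\neq\emptyset$, the algorithm stops after not more than $$\left\lceil\frac{2\Theta_0^2M^2}{\gamma^2\varepsilon^2}\Big(1+\frac1\gamma\Big)^2\right\rceil$$ iterations, and it returns $\hat x=\arg\min_{i\in I}f(x_i)$ (a point $x_i$, $i\in I$, with the smallest value of $f$) such that $f(\hat x)-f(x_* )\le\varepsilon$ and $g(\hat x)\le\varepsilon$.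
   Context: $(\mathbf{E},\|\cdot\|)$ is a finite-dimensional normed space with dual $\mathbf{E}^*$ and dual norm $\|y\|_*=\max\{\langle y,x\rangle:\|x\|\le1\}$. $Q\subset\mathbf{E}$ is closed and convex. $d:Q\to\mathbb{R}$ is a proper, closed, differentiable function that is $1$-strongly convex with respect to $\|\cdot\|$ (prox-function). The Bregman divergence is $V(y,x)=d(y)-d(x)-\langle\nabla d(x),y-x\rangle$, $x,y\in Q$; it satisfies $V(y,x)\ge\frac12\|y-x\|^2$. The proximal mapping is $\operatorname{Mirr}_x(p)=\arg\min_{u\in Q}\{\langle p,u\rangle+V(u,x)\}$ for $x\in Q$, $p\in\mathbf{E}^*$. For a function $\phi$ on $Q$, $\nabla\phi(x)\in\partial\phi(x)$ denotes an arbitrary (sub)gradient of $\phi$ at $x$. A function $\phi$ is Lipschitz continuous with constant $M'$ if $|\phi(x)-\phi(y)|\le M'\|x-y\|$ for all $x,y\in Q$; this is understood to mean also $\|\nabla\phi(x)\|_*\le M'$ for all $x\in Q$. For $\gamma\in(0,1]$, $f:Q\to\mathbb{R}$ is $\gamma$-quasar convex with center $x_*\in Q$ if $x_*\in\arg\min_{x\in Q}f(x)$ and $f(x_* )\ge f(x)+\frac1\gamma\langle\nabla f(x),x_*-x\rangle$ for all $x\in Q$. The problem is assumed feasible (regular): there is a point $\bar x$ in the interior of $Q$ with $g(\bar x)\le0$. *)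

theory Defs
  imports "HOL-Analysis.Analysis"
begin

text \<open>
  The space is a type of class \<open>real_normed_vector\<close>, so the norm is arbitrary; finite dimension is
  a separate predicate.  Dual vectors have type \<open>'a \<Rightarrow>\<^sub>L real\<close>, whose norm is the operator norm,
  i.e. the dual norm.  Functions on \<open>Q\<close> are total functions of which only the values
  on \<open>Q\<close> matter.
\<close>

definition finite_dimensional :: "'a::real_normed_vector itself \<Rightarrow> bool" where
  "finite_dimensional _ \<longleftrightarrow> (\<exists>B::'a set. finite B \<and> span B = UNIV)"

definition strongly_convex_on ::
    "'a::real_normed_vector set \<Rightarrow> real \<Rightarrow> ('a \<Rightarrow> real) \<Rightarrow> bool" where
  "strongly_convex_on Q \<mu> d \<longleftrightarrow>
     (\<forall>x\<in>Q. \<forall>y\<in>Q. \<forall>t\<in>{0..1}.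
        d ((1 - t) *\<^sub>R x + t *\<^sub>R y)
          \<le> (1 - t) * d x + t * d y - \<mu> / 2 * t * (1 - t) * (norm (x - y))\<^sup>2)"

text \<open>
  Since \<open>d\<close> is real-valued on \<open>Q\<close>, properness means that \<open>Q\<close> is nonempty.  Differentiability is
  relative to \<open>Q\<close>; as \<open>Q\<close> is convex with nonempty interior in the intended use, the derivative
  within \<open>Q\<close> is unique also at boundary points.
\<close>

definition prox_function :: "'a::real_normed_vector set \<Rightarrow> ('a \<Rightarrow> real) \<Rightarrow> bool" where
  "prox_function Q d \<longleftrightarrow>
     Q \<noteq> {} \<and> closed (epigraph Q d) \<and> d differentiable_on Q \<and> strongly_convex_on Q 1 d"

definition bregman ::
    "'a::real_normed_vector set \<Rightarrow> ('a \<Rightarrow> real) \<Rightarrow> 'a \<Rightarrow> 'a \<Rightarrow> real" where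
  "bregman Q d y x = d y - d x - frechet_derivative d (at x within Q) (y - x)"

definition Mirr ::
    "'a::real_normed_vector set \<Rightarrow> ('a \<Rightarrow> real) \<Rightarrow> 'a \<Rightarrow> ('a \<Rightarrow>\<^sub>L real) \<Rightarrow> 'a" where
  "Mirr Q d x p = arg_min_on (\<lambda>u. blinfun_apply p u + bregman Q d u x) Q"

definition convex_subdifferential ::
    "'a::real_normed_vector set \<Rightarrow> ('a \<Rightarrow> real) \<Rightarrow> 'a \<Rightarrow> ('a \<Rightarrow>\<^sub>L real) set" where
  "convex_subdifferential Q \<phi> x =
     {p. \<forall>y\<in>Q. \<phi> y \<ge> \<phi> x + blinfun_apply p (y - x)}"

text \<open>
  A quasar convex function need not be convex, so its subgradients are taken in the sense of Clarke:
  \<open>p v\<close> is bounded by the generalised directional derivative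
  \[ \limsup_{y \to x,\, t \downarrow 0} \frac{\phi(y + t v) - \phi(y)}{t}, \]
  where only points \<open>y\<close> and \<open>y + t v\<close> of \<open>Q\<close> are used because \<open>\<phi>\<close> lives on \<open>Q\<close>.  For the same reason
  only the directions \<open>v = z - x\<close> with \<open>z\<close> in \<open>Q\<close> are tested; at an interior point these are
  all directions up to scaling.  Every derivative of \<open>\<phi>\<close> within \<open>Q\<close> and every convex subgradient
  is a Clarke subgradient in this sense.
\<close>

definition clarke_derivative ::
    "'a::real_normed_vector set \<Rightarrow> ('a \<Rightarrow> real) \<Rightarrow> 'a \<Rightarrow> 'a \<Rightarrow> ereal" where
  "clarke_derivative Q \<phi> x v =
     Limsup (at (x, 0) within {(y, t). y \<in> Q \<and> 0 < t \<and> y + t *\<^sub>R v \<in> Q})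
       (\<lambda>(y, t). ereal ((\<phi> (y + t *\<^sub>R v) - \<phi> y) / t))"

definition clarke_subdifferential ::
    "'a::real_normed_vector set \<Rightarrow> ('a \<Rightarrow> real) \<Rightarrow> 'a \<Rightarrow> ('a \<Rightarrow>\<^sub>L real) set" where
  "clarke_subdifferential Q \<phi> x =
     {p. \<forall>z\<in>Q. ereal (blinfun_apply p (z - x)) \<le> clarke_derivative Q \<phi> x (z - x)}"

text \<open>In the next definition \<open>f'\<close> is the chosen (sub)gradient field of \<open>f\<close>.\<close>

definition quasar_convex ::
    "'a::real_normed_vector set \<Rightarrow> real \<Rightarrow> ('a \<Rightarrow> real) \<Rightarrow> ('a \<Rightarrow> ('a \<Rightarrow>\<^sub>L real)) \<Rightarrow> 'a \<Rightarrow> bool" where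
  "quasar_convex Q \<gamma> f f' xs \<longleftrightarrow>
     is_arg_min f (\<lambda>x. x \<in> Q) xs \<and>
     (\<forall>x\<in>Q. f xs \<ge> f x + 1 / \<gamma> * blinfun_apply (f' x) (xs - x))"

primrec mirror_descent ::
    "'a::real_normed_vector set \<Rightarrow> ('a \<Rightarrow> real) \<Rightarrow> ('a \<Rightarrow> ('a \<Rightarrow>\<^sub>L real)) \<Rightarrow>
     ('a \<Rightarrow> real) \<Rightarrow> ('a \<Rightarrow> ('a \<Rightarrow>\<^sub>L real)) \<Rightarrow> real \<Rightarrow> real \<Rightarrow> 'a \<Rightarrow> nat \<Rightarrow> 'a" where
  "mirror_descent Q d f' g g' \<epsilon> h x0 0 = x0"
| "mirror_descent Q d f' g g' \<epsilon> h x0 (Suc k) =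
     (let x = mirror_descent Q d f' g g' \<epsilon> h x0 k
      in if g x \<le> \<epsilon> then Mirr Q d x (h *\<^sub>R f' x) else Mirr Q d x (h *\<^sub>R g' x))"

end

theory Submission
  imports Defs
begin

text \<open>
  Mirror descent makes progress towards every fixed comparison point \<open>u\<close> of \<open>Q\<close>, as measured
  by the Bregman divergence.  If \<open>x'\<close> is the proximal step from \<open>x\<close> with the covector \<open>p\<close>, then
  the first-order optimality of \<open>x'\<close> gives
  \<open>p (x' - u) \<le> V(u, x) - V(u, x') - V(x', x)\<close>, and strong convexity gives
  \<open>V(x', x) \<ge> norm (x' - x)^2 / 2\<close>.  This quadratic term pays for replacing \<open>x'\<close> by
  \<open>x\<close> on the left, so that \<open>p (x - u) \<le> V(u, x) - V(u, x') + norm p ^ 2 / 2\<close>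
  (lemma \<open>Mirr_step\<close>).  Along the iteration the divergences telescope
  (lemma \<open>sum_subgradients_le\<close>).

  Take \<open>u = x\<^sub>*\<close>.  If the step is non-productive, convexity of \<open>g\<close> bounds
  the pairing \<open>\<nabla>g(x) (x - x\<^sub>*)\<close> from below by \<open>g(x) - g(x\<^sub>*) > \<epsilon> \<ge> \<gamma> \<epsilon>\<close>.  If it is
  productive, quasar convexity bounds \<open>\<nabla>f(x) (x - x\<^sub>*)\<close> from below by
  \<open>\<gamma> (f(x) - f(x\<^sub>*))\<close>.  Were \<open>f(x) - f(x\<^sub>*) > \<epsilon>\<close> at every productive point, each of the
  \<open>k\<close> pairings would exceed \<open>\<gamma> \<epsilon>\<close>, while their sum is at most
  \<open>\<Theta>\<^sub>0^2 / h + k h M^2 / 2 = \<Theta>\<^sub>0^2 M^2 / (\<gamma> \<epsilon>) + k \<gamma> \<epsilon> / 2\<close>.  This forces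
  \<open>k < 2 \<Theta>\<^sub>0^2 M^2 / (\<gamma> \<epsilon>)^2\<close>, against the stopping rule.  So some productive point is
  \<open>\<epsilon>\<close>-optimal; in particular a productive step occurs.

  The proximal step is well defined because \<open>Q\<close> is compact: the bound on the divergence together
  with strong convexity makes \<open>Q\<close> bounded, and closed bounded sets of a finite-dimensional normed
  space are compact (lemma \<open>finite_dimensional_compact\<close>).
\<close>

section \<open>Compactness in finite-dimensional normed spaces\<close>

text \<open>
  Induction on the spanning set.  When a vector \<open>b\<close> outside \<open>span B\<close> is added, the
  induction hypothesis makes \<open>span B\<close> closed, so \<open>b\<close> has positive distance from it; this bounds
  the \<open>b\<close>-coordinates of a bounded sequence, and a subsequence can be extracted first for the
  coordinates and then for the remainders in \<open>span B\<close>.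
\<close>

lemma bounded_sequence_in_span_has_limit:
  fixes X :: "nat \<Rightarrow> 'a::real_normed_vector"
  assumes "finite B" "bounded (range X)" "range X \<subseteq> span B"
  shows "\<exists>l\<in>span B. \<exists>r. strict_mono r \<and> (X \<circ> r) \<longlonglongrightarrow> l"
  using assms
proof (induction B arbitrary: X rule: finite_induct)
  case empty
  then have "X = (\<lambda>_. 0)" by auto
  then have "(X \<circ> id) \<longlonglongrightarrow> 0" by simp
  then show ?case using strict_mono_id span_zero by blast
next
  case (insert b B)
  show ?case
  proof (cases "b \<in> span B")
    case True
    then show ?thesis using insert by (simp add: span_redundant)
  next
    case False
    have "closed (span B)"
      unfolding closed_sequential_limits
    proof (intro allI impI, elim conjE)
      fix Y l assume Y: "\<forall>n. Y n \<in> span B" "Y \<longlonglongrightarrow> l"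
      have "bounded (range Y)"
        using Y(2) by (rule convergent_imp_bounded)
      then obtain l' r where "l' \<in> span B" "strict_mono r" "(Y \<circ> r) \<longlonglongrightarrow> l'"
        using insert.IH[of Y] Y(1) by blast
      then show "l \<in> span B"
        using LIMSEQ_subseq_LIMSEQ[OF Y(2)] LIMSEQ_unique by blast
    qed
    then obtain \<delta> where \<delta>: "0 < \<delta>" "ball b \<delta> \<subseteq> - span B"
      using False by (meson ComplI open_Compl open_contains_ball)
    have \<delta>_le: "\<delta> \<le> dist s b" if "s \<in> span B" for s
    proof (rule ccontr)
      assume "\<not> \<delta> \<le> dist s b"
      then have "s \<in> ball b \<delta>" by (simp add: dist_commute)
      then show False using \<delta>(2) that by blast
    qed
    have "\<forall>n. \<exists>c. X n - c *\<^sub>R b \<in> span B"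
      using insert.prems(2) by (simp add: image_subset_iff flip: span_breakdown_eq)
    then obtain c where c: "\<And>n. X n - c n *\<^sub>R b \<in> span B" by metis
    have c_le: "\<bar>c n\<bar> * \<delta> \<le> norm (X n)" for n
    proof (cases "c n = 0")
      case False
      have "- (1 / c n) *\<^sub>R (X n - c n *\<^sub>R b) \<in> span B"
        using c span_scale by blast
      then have "\<delta> \<le> dist (- (1 / c n) *\<^sub>R (X n - c n *\<^sub>R b)) b"
        by (rule \<delta>_le)
      also have "\<dots> = norm (X n) / \<bar>c n\<bar>"
        using False by (simp add: dist_norm scaleR_diff_right divide_inverse mult.commute)
      finally show ?thesis using False by (simp add: field_simps)
    qed simp
    obtain C where C: "\<And>n. norm (X n) \<le> C"
      using insert.prems(1) by (auto simp: bounded_iff)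
    have "\<bar>c n\<bar> \<le> C / \<delta>" for n
      using c_le[of n] C[of n] \<delta>(1) by (simp add: field_simps)
    then have "bounded (range c)" by (auto simp: bounded_iff)
    then obtain c0 r1 where r1: "strict_mono r1" "(c \<circ> r1) \<longlonglongrightarrow> c0"
      using bounded_imp_convergent_subsequence by blast
    define Y where "Y = (\<lambda>n. X (r1 n) - c (r1 n) *\<^sub>R b)"
    have "norm (Y n) \<le> C + C / \<delta> * norm b" for n
    proof -
      have "norm (Y n) \<le> norm (X (r1 n)) + \<bar>c (r1 n)\<bar> * norm b"
        unfolding Y_def by (metis norm_scaleR norm_triangle_ineq4)
      also have "\<dots> \<le> C + C / \<delta> * norm b"
        using C \<open>\<And>n. \<bar>c n\<bar> \<le> C / \<delta>\<close> by (intro add_mono mult_right_mono) auto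
      finally show ?thesis .
    qed
    then have "bounded (range Y)" by (auto simp: bounded_iff)
    moreover have "range Y \<subseteq> span B" using c by (auto simp: Y_def)
    ultimately obtain s r2 where s: "s \<in> span B" and r2: "strict_mono r2" "(Y \<circ> r2) \<longlonglongrightarrow> s"
      using insert.IH by blast
    have "(c \<circ> r1 \<circ> r2) \<longlonglongrightarrow> c0"
      using LIMSEQ_subseq_LIMSEQ[OF r1(2) r2(1)] .
    then have "(\<lambda>n. (Y \<circ> r2) n + (c \<circ> r1 \<circ> r2) n *\<^sub>R b) \<longlonglongrightarrow> s + c0 *\<^sub>R b"
      using r2(2) by (intro tendsto_intros)
    then have "(X \<circ> (r1 \<circ> r2)) \<longlonglongrightarrow> s + c0 *\<^sub>R b"
      by (simp add: Y_def o_def)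
    moreover have "strict_mono (r1 \<circ> r2)" using r1(1) r2(1) by (rule strict_mono_o)
    moreover have "s + c0 *\<^sub>R b \<in> span (insert b B)"
      using s unfolding span_breakdown_eq by (intro exI[of _ c0]) simp
    ultimately show ?thesis by blast
  qed
qed

lemma finite_dimensional_compact:
  fixes S :: "'a::real_normed_vector set"
  assumes "finite_dimensional TYPE('a)" "closed S" "bounded S"
  shows "compact S"
  unfolding compact_def
proof (intro allI impI)
  fix X :: "nat \<Rightarrow> 'a" assume X: "\<forall>n. X n \<in> S"
  obtain B :: "'a set" where "finite B" "span B = UNIV"
    using assms(1) by (auto simp: finite_dimensional_def)
  moreover have "bounded (range X)"
    using X bounded_subset[OF assms(3)] by blast
  ultimately obtain l r where "strict_mono r" "(X \<circ> r) \<longlonglongrightarrow> l"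
    using bounded_sequence_in_span_has_limit[of B X] by auto
  moreover from this have "l \<in> S"
    using X closed_sequentially[OF assms(2), of "X \<circ> r" l] by simp
  ultimately show "\<exists>l\<in>S. \<exists>r. strict_mono r \<and> (X \<circ> r) \<longlonglongrightarrow> l" by blast
qed

section \<open>The Bregman divergence\<close>

text \<open>
  At a boundary point of \<open>Q\<close> a derivative within \<open>Q\<close> is only controlled along directions that point
  into \<open>Q\<close>.  By convexity these include \<open>y - x\<close> for every \<open>y\<close> in \<open>Q\<close>: the segment from
  \<open>x\<close> to \<open>y\<close> stays in \<open>Q\<close>, and the chain rule along it gives a one-sided limit.
\<close>

lemma directional_derivative_within:
  fixes \<phi> :: "'a::real_normed_vector \<Rightarrow> real"
  assumes D: "(\<phi> has_derivative D) (at x within Q)"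
    and "convex Q" "x \<in> Q" "y \<in> Q"
  shows "((\<lambda>t. (\<phi> (x + t *\<^sub>R (y - x)) - \<phi> x) / t) \<longlongrightarrow> D (y - x)) (at_right 0)"
proof -
  define c where "c = (\<lambda>t. x + t *\<^sub>R (y - x))"
  have "c ` {0..1} \<subseteq> Q"
  proof clarify
    fix t :: real assume "t \<in> {0..1}"
    then have "(1 - t) *\<^sub>R x + t *\<^sub>R y \<in> Q"
      using assms by (intro convexD) auto
    then show "c t \<in> Q" by (simp add: c_def algebra_simps)
  qed
  moreover have "c 0 = x" by (simp add: c_def)
  ultimately have D': "(\<phi> has_derivative D) (at (c 0) within c ` {0..1})"
    using D has_derivative_subset by metis
  have "(c has_derivative (\<lambda>t. t *\<^sub>R (y - x))) (at 0 within {0..1})"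
    unfolding c_def by (auto intro!: derivative_eq_intros)
  from diff_chain_within[OF this D']
  have "(\<phi> \<circ> c has_derivative (\<lambda>t. D (t *\<^sub>R (y - x)))) (at 0 within {0..1})"
    by (simp add: o_def)
  also have "(\<lambda>t. D (t *\<^sub>R (y - x))) = (*) (D (y - x))"
    using linear_scale[OF has_derivative_linear[OF D]] by (auto simp: mult.commute)
  finally have "(\<phi> \<circ> c has_field_derivative D (y - x)) (at 0 within {0..1})"
    by (simp only: has_field_derivative_def)
  then show ?thesis
    by (simp add: has_field_derivative_iff at_within_Icc_at_right c_def)
qed

text \<open>
  Dividing the inequality of strong convexity by \<open>t\<close> and letting \<open>t\<close> tend to \<open>0\<close> turns the
  difference quotient of \<open>d\<close> into the derivative at \<open>x\<close>.
\<close>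

lemma bregman_ge_half_square:
  fixes Q :: "'a::real_normed_vector set"
  assumes "prox_function Q d" "convex Q" "x \<in> Q" "y \<in> Q"
  shows "bregman Q d y x \<ge> (norm (y - x))\<^sup>2 / 2"
proof -
  define D where "D = frechet_derivative d (at x within Q)"
  have D: "(d has_derivative D) (at x within Q)"
    using assms unfolding D_def prox_function_def differentiable_on_def
    by (simp add: frechet_derivative_works)
  have "((\<lambda>t. d y - d x - 1/2 * (1 - t) * (norm (y - x))\<^sup>2) \<longlongrightarrow>
      d y - d x - 1/2 * (1 - 0) * (norm (y - x))\<^sup>2) (at_right (0::real))"
    by (intro tendsto_intros)
  moreover have "((\<lambda>t. (d (x + t *\<^sub>R (y - x)) - d x) / t) \<longlongrightarrow> D (y - x)) (at_right 0)"
    using directional_derivative_within[OF D] assms by blast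
  moreover have "eventually (\<lambda>t. (d (x + t *\<^sub>R (y - x)) - d x) / t
      \<le> d y - d x - 1/2 * (1 - t) * (norm (y - x))\<^sup>2) (at_right (0::real))"
    using eventually_at_right_real[of 0 1]
  proof (rule eventually_mono)
    fix t :: real assume t: "t \<in> {0<..<1}"
    have "d ((1 - t) *\<^sub>R x + t *\<^sub>R y)
        \<le> (1 - t) * d x + t * d y - 1 / 2 * t * (1 - t) * (norm (x - y))\<^sup>2"
      using assms t by (simp add: prox_function_def strongly_convex_on_def)
    also have "(1 - t) *\<^sub>R x + t *\<^sub>R y = x + t *\<^sub>R (y - x)"
      by (simp add: algebra_simps)
    finally have "d (x + t *\<^sub>R (y - x)) - d x
        \<le> t * (d y - d x - 1/2 * (1 - t) * (norm (y - x))\<^sup>2)"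
      by (simp add: algebra_simps norm_minus_commute)
    then show "(d (x + t *\<^sub>R (y - x)) - d x) / t
      \<le> d y - d x - 1/2 * (1 - t) * (norm (y - x))\<^sup>2"
      using t by (simp add: pos_divide_le_eq mult.commute)
  qed simp
  ultimately have "D (y - x) \<le> d y - d x - 1/2 * (1 - 0) * (norm (y - x))\<^sup>2"
    by (intro tendsto_le[OF trivial_limit_at_right_real])
  then show ?thesis by (simp add: bregman_def D_def)
qed

lemma bounded_if_bregman_bounded:
  fixes Q :: "'a::real_normed_vector set"
  assumes "prox_function Q d" "convex Q"
    and le: "\<And>y z. y \<in> Q \<Longrightarrow> z \<in> Q \<Longrightarrow> bregman Q d y z \<le> C"
  shows "bounded Q"
proof -
  obtain z where z: "z \<in> Q" using assms(1) by (auto simp: prox_function_def)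
  have "dist z y \<le> sqrt (2 * C)" if "y \<in> Q" for y
    using bregman_ge_half_square[OF assms(1,2) z that] le[OF that z]
    by (intro real_le_rsqrt) (simp add: dist_norm norm_minus_commute)
  then show ?thesis unfolding bounded_def by blast
qed

section \<open>The proximal step\<close>

lemma Mirr_is_arg_min:
  assumes "prox_function Q d" "compact Q" "x \<in> Q"
  shows "is_arg_min (\<lambda>u. blinfun_apply p u + bregman Q d u x) (\<lambda>u. u \<in> Q) (Mirr Q d x p)"
proof -
  let ?F = "\<lambda>u. blinfun_apply p u + bregman Q d u x"
  have "(d has_derivative frechet_derivative d (at x within Q)) (at x within Q)"
    using assms by (simp add: prox_function_def differentiable_on_def frechet_derivative_works)
  then have "bounded_linear (frechet_derivative d (at x within Q))"
    by (rule has_derivative_bounded_linear)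
  then have "continuous_on Q (\<lambda>u. frechet_derivative d (at x within Q) (u - x))"
    by (rule bounded_linear.continuous_on) (intro continuous_intros)
  moreover have "continuous_on Q d"
    using assms(1) by (simp add: prox_function_def differentiable_imp_continuous_on)
  ultimately have "continuous_on Q ?F"
    unfolding bregman_def by (intro continuous_intros)
  moreover have "Q \<noteq> {}" using assms(3) by blast
  ultimately obtain u where "u \<in> Q" "\<And>v. v \<in> Q \<Longrightarrow> ?F u \<le> ?F v"
    using continuous_attains_inf[OF assms(2)] by blast
  then have "is_arg_min ?F (\<lambda>u. u \<in> Q) u"
    by (auto simp: is_arg_min_def not_less)
  then show ?thesis
    unfolding Mirr_def arg_min_on_def arg_min_def by (rule someI)
qed

text \<open>
  The right-hand side arises from the first-order condition
  \<open>p (u - x') + (d'(x') - d'(x)) (u - x') \<ge> 0\<close> by the three-point identity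
  \<open>(d'(x') - d'(x)) (u - x') = V(u, x) - V(u, x') - V(x', x)\<close>.
\<close>

lemma Mirr_three_point:
  fixes Q :: "'a::real_normed_vector set" and p :: "'a \<Rightarrow>\<^sub>L real"
  assumes "prox_function Q d" "compact Q" "convex Q" "x \<in> Q" "u \<in> Q"
  defines "x' \<equiv> Mirr Q d x p"
  shows "blinfun_apply p (x' - u) \<le> bregman Q d u x - bregman Q d u x' - bregman Q d x' x"
proof -
  define F where "F = (\<lambda>u. blinfun_apply p u + bregman Q d u x)"
  define D where "D z = frechet_derivative d (at z within Q)" for z
  have D: "(d has_derivative D z) (at z within Q)" if "z \<in> Q" for z
    using that assms(1)
    by (simp add: D_def prox_function_def differentiable_on_def frechet_derivative_works)
  have min: "x' \<in> Q" "\<And>v. v \<in> Q \<Longrightarrow> F x' \<le> F v"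
    using Mirr_is_arg_min[OF assms(1,2,4), of p]
    by (auto simp: is_arg_min_def not_less x'_def F_def)
  have lin: "linear (D x)" using D[OF assms(4)] has_derivative_linear by blast
  have "(D x has_derivative D x) (at x' within Q)"
    using D[OF assms(4)] by (simp add: bounded_linear_imp_has_derivative has_derivative_bounded_linear)
  moreover have "F = (\<lambda>v. blinfun_apply p v + (d v - d x - (D x v - D x x)))"
    by (simp add: F_def bregman_def D_def[symmetric] linear_diff[OF lin])
  ultimately have "(F has_derivative (\<lambda>v. p v + (D x' v - D x v))) (at x' within Q)"
    by (auto intro!: derivative_eq_intros D min)
  from directional_derivative_within[OF this assms(3) min(1) assms(5)]
  have "((\<lambda>t. (F (x' + t *\<^sub>R (u - x')) - F x') / t) \<longlongrightarrow>
      p (u - x') + (D x' (u - x') - D x (u - x'))) (at_right 0)" .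
  moreover have "eventually (\<lambda>t. 0 \<le> (F (x' + t *\<^sub>R (u - x')) - F x') / t) (at_right (0::real))"
    using eventually_at_right_real[of 0 1]
  proof (rule eventually_mono)
    fix t :: real assume t: "t \<in> {0<..<1}"
    have "(1 - t) *\<^sub>R x' + t *\<^sub>R u \<in> Q"
      using t assms min(1) by (intro convexD) auto
    then have "F x' \<le> F (x' + t *\<^sub>R (u - x'))"
      by (intro min) (simp add: algebra_simps)
    then show "0 \<le> (F (x' + t *\<^sub>R (u - x')) - F x') / t" using t by simp
  qed simp
  ultimately have "0 \<le> p (u - x') + (D x' (u - x') - D x (u - x'))"
    using tendsto_lowerbound trivial_limit_at_right_real by blast
  moreover have "p (x' - u) = - p (u - x')"
    by (metis blinfun.minus_right minus_diff_eq)
  moreover have "bregman Q d u x - bregman Q d u x' - bregman Q d x' x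
      = D x' (u - x') - D x (u - x')"
    by (simp add: bregman_def D_def[symmetric] linear_diff[OF lin])
  ultimately show ?thesis by simp
qed

text \<open>
  The cost of evaluating \<open>p\<close> at \<open>x - u\<close> instead of \<open>x' - u\<close> is at most
  \<open>norm p * norm (x' - x) \<le> norm p ^ 2 / 2 + norm (x' - x) ^ 2 / 2\<close>, and the second term is
  absorbed by \<open>- V(x', x)\<close>.
\<close>

lemma Mirr_step:
  assumes "prox_function Q d" "compact Q" "convex Q" "x \<in> Q" "u \<in> Q"
  shows "blinfun_apply p (x - u)
    \<le> bregman Q d u x - bregman Q d u (Mirr Q d x p) + (norm p)\<^sup>2 / 2"
proof -
  define x' where "x' = Mirr Q d x p"
  have "x' \<in> Q"
    using Mirr_is_arg_min[OF assms(1,2,4)] by (simp add: is_arg_min_def x'_def)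
  have "p (x - u) = p (x - x') + p (x' - u)"
    by (simp flip: blinfun.add_right)
  also have "p (x - x') \<le> norm p * norm (x' - x)"
    using norm_blinfun[of p "x - x'"] by (simp add: norm_minus_commute)
  also have "norm p * norm (x' - x) \<le> (norm p)\<^sup>2 / 2 + (norm (x' - x))\<^sup>2 / 2"
    using sum_squares_bound[of "norm p" "norm (x' - x)"] by simp
  also have "(norm (x' - x))\<^sup>2 / 2 \<le> bregman Q d x' x"
    using bregman_ge_half_square assms \<open>x' \<in> Q\<close> by blast
  also have "p (x' - u) \<le> bregman Q d u x - bregman Q d u x' - bregman Q d x' x"
    using Mirr_three_point[OF assms] by (simp add: x'_def)
  finally show ?thesis by (simp add: x'_def)
qed

text \<open>
  The covectors \<open>q k\<close> are arbitrary, so that productive and non-productive steps enter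
  one telescoping sum.  The last divergence is dropped because it is nonnegative.
\<close>

lemma sum_subgradients_le:
  assumes "prox_function Q d" "compact Q" "convex Q" "u \<in> Q" "y 0 \<in> Q"
    and step: "\<And>k. y (Suc k) = Mirr Q d (y k) (h *\<^sub>R q k)"
    and q: "\<And>k. y k \<in> Q \<Longrightarrow> norm (q k) \<le> M"
  shows "y k \<in> Q"
    and "h * (\<Sum>i<k. blinfun_apply (q i) (y i - u)) \<le> bregman Q d u (y 0) + real k * (h\<^sup>2 * M\<^sup>2 / 2)"
proof -
  have Q: "y k \<in> Q" for k
  proof (induction k)
    case (Suc k)
    then show ?case
      using Mirr_is_arg_min[OF assms(1,2)] by (auto simp: is_arg_min_def step)
  qed (fact assms(5))
  show "y k \<in> Q" by (rule Q)
  have "h * (\<Sum>i<k. q i (y i - u))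
      \<le> bregman Q d u (y 0) - bregman Q d u (y k) + real k * (h\<^sup>2 * M\<^sup>2 / 2)"
  proof (induction k)
    case (Suc k)
    have "h * q k (y k - u)
        \<le> bregman Q d u (y k) - bregman Q d u (y (Suc k)) + (norm (h *\<^sub>R q k))\<^sup>2 / 2"
      using Mirr_step[OF assms(1-3) Q[of k] assms(4), of "h *\<^sub>R q k"]
      by (simp add: step blinfun.scaleR_left)
    also have "(norm (h *\<^sub>R q k))\<^sup>2 \<le> h\<^sup>2 * M\<^sup>2"
      using q[OF Q] by (simp add: power_mult_distrib mult_left_mono power_mono)
    finally show ?case using Suc.IH by (simp add: algebra_simps add_divide_distrib)
  qed simp
  moreover have "0 \<le> bregman Q d u (y k)"
    using bregman_ge_half_square[OF assms(1,3) Q assms(4)]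
    by (meson divide_nonneg_nonneg order_trans zero_le_numeral zero_le_power2)
  ultimately show "h * (\<Sum>i<k. q i (y i - u)) \<le> bregman Q d u (y 0) + real k * (h\<^sup>2 * M\<^sup>2 / 2)"
    by linarith
qed

section \<open>Convergence under quasar convexity\<close>

theorem theorem4p6:
  fixes Q :: "'a::real_normed_vector set"
    and d f g :: "'a \<Rightarrow> real"
    and f' g' :: "'a \<Rightarrow> ('a \<Rightarrow>\<^sub>L real)"
    and xs x0 :: 'a
    and \<gamma> Mf Mg M \<Theta>0 \<epsilon> h K :: real
    and x :: "nat \<Rightarrow> 'a"
  assumes "finite_dimensional TYPE('a)"
    and "closed Q" and "convex Q"
    and "prox_function Q d"
    and "0 < \<gamma>" and "\<gamma> \<le> 1"
    and "0 < Mf" and "0 < Mg"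
    and "Mf-lipschitz_on Q f"
    and "\<forall>z\<in>Q. f' z \<in> clarke_subdifferential Q f z \<and> norm (f' z) \<le> Mf"
    and "quasar_convex Q \<gamma> f f' xs"
    and "convex_on Q g"
    and "Mg-lipschitz_on Q g"
    and "\<forall>z\<in>Q. g' z \<in> convex_subdifferential Q g z \<and> norm (g' z) \<le> Mg"
    and "\<exists>xbar\<in>interior Q. g xbar \<le> 0"
    and "is_arg_min f (\<lambda>z. z \<in> Q \<and> g z \<le> 0) xs"
    and "0 < \<Theta>0"
    and "\<forall>z\<in>Q. \<forall>y\<in>Q. bregman Q d y z \<le> \<Theta>0\<^sup>2"
    and "0 < \<epsilon>"
    and "x0 \<in> Q"
  defines "M \<equiv> max Mf Mg"
    and "h \<equiv> \<gamma> * \<epsilon> / M\<^sup>2"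
    and "x \<equiv> mirror_descent Q d f' g g' \<epsilon> h x0"
    and "K \<equiv> 2 * \<Theta>0\<^sup>2 * M\<^sup>2 / (\<gamma>\<^sup>2 * \<epsilon>\<^sup>2) * (1 + 1 / \<gamma>)\<^sup>2"
  shows "\<exists>k. K \<le> real k \<and> (\<forall>j<k. \<not> K \<le> real j) \<and>
     int k \<le> \<lceil>K\<rceil> \<and>
     (let I = {i. i < k \<and> g (x i) \<le> \<epsilon>} in
        I \<noteq> {} \<and>
        (\<exists>xhat. is_arg_min f (\<lambda>z. z \<in> x ` I) xhat) \<and>
        (\<forall>xhat. is_arg_min f (\<lambda>z. z \<in> x ` I) xhat \<longrightarrow>
           xhat \<in> Q \<and> f xhat - f xs \<le> \<epsilon> \<and> g xhat \<le> \<epsilon>))"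
proof -
  have pf: "prox_function Q d" and cv: "convex Q" by fact+
  have cpt: "compact Q"
    using assms bounded_if_bregman_bounded[OF pf cv, of "\<Theta>0\<^sup>2"] finite_dimensional_compact
    by blast
  have xs: "xs \<in> Q" "g xs \<le> 0"
    using assms(16) by (auto simp: is_arg_min_def)
  have M: "0 < M" and h: "0 < h" using assms(5,7,19) by (auto simp: M_def h_def less_max_iff_disj)
  define q where "q = (\<lambda>k. if g (x k) \<le> \<epsilon> then f' (x k) else g' (x k))"
  have step: "x (Suc k) = Mirr Q d (x k) (h *\<^sub>R q k)" for k
    by (simp add: x_def q_def Let_def)
  have q: "norm (q k) \<le> M" if "x k \<in> Q" for k
    using that assms(10,14) by (force simp: q_def M_def)
  have x0: "x 0 \<in> Q" using assms(20) by (simp add: x_def)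
  note descent = sum_subgradients_le[where y = x and q = q and M = M, OF pf cpt cv xs(1) x0 step q]
  have x_Q: "x k \<in> Q" for k by (rule descent(1))
  have productive: "\<gamma> * (f (x i) - f xs) \<le> q i (x i - xs)" if "g (x i) \<le> \<epsilon>" for i
  proof -
    have "f (x i) + 1 / \<gamma> * f' (x i) (xs - x i) \<le> f xs"
      using assms(11) x_Q[of i] by (simp add: quasar_convex_def)
    moreover have "f' (x i) (xs - x i) = - q i (x i - xs)"
      using that by (simp add: q_def flip: blinfun.minus_right)
    ultimately show ?thesis using assms(5) by (simp add: field_simps)
  qed
  have nonproductive: "\<gamma> * \<epsilon> < q i (x i - xs)" if "\<not> g (x i) \<le> \<epsilon>" for i
  proof -
    have "g (x i) + g' (x i) (xs - x i) \<le> g xs"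
      using assms(14) x_Q[of i] xs(1) by (auto simp: convex_subdifferential_def)
    moreover have "g' (x i) (xs - x i) = - q i (x i - xs)"
      using that by (simp add: q_def flip: blinfun.minus_right)
    moreover have "\<gamma> * \<epsilon> \<le> \<epsilon>" using assms(6,19) by simp
    ultimately show ?thesis using that xs(2) by linarith
  qed

  define k where "k = nat \<lceil>K\<rceil>"
  have "0 < 1 + 1 / \<gamma>" using assms(5) by (simp add: add_pos_pos)
  then have "0 < K"
    unfolding K_def using M assms(5,17,19)
    by (intro mult_pos_pos divide_pos_pos zero_less_power) auto
  then have k: "K \<le> real k" "0 < k" "int k = \<lceil>K\<rceil>" "\<And>j. j < k \<Longrightarrow> \<not> K \<le> real j"
    by (auto simp: k_def) linarith+
  define I where "I = {i. i < k \<and> g (x i) \<le> \<epsilon>}"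
  have good: "\<exists>i\<in>I. f (x i) - f xs \<le> \<epsilon>"
  proof (rule ccontr)
    assume bad: "\<not> ?thesis"
    have "\<gamma> * \<epsilon> < q i (x i - xs)" if "i < k" for i
    proof (cases "g (x i) \<le> \<epsilon>")
      case True
      then have "\<gamma> * \<epsilon> < \<gamma> * (f (x i) - f xs)"
        using bad that assms(5) by (auto simp: I_def not_le)
      then show ?thesis using productive[OF True] by linarith
    qed (rule nonproductive)
    then have "(\<Sum>i<k. \<gamma> * \<epsilon>) < (\<Sum>i<k. q i (x i - xs))"
      using k(2) by (intro sum_strict_mono) auto
    then have "h * (real k * (\<gamma> * \<epsilon>)) < h * (\<Sum>i<k. q i (x i - xs))"
      using h by simp
    also have "\<dots> \<le> \<Theta>0\<^sup>2 + real k * (h\<^sup>2 * M\<^sup>2 / 2)"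
      using descent(2)[of k] assms(18) xs(1) x0 by fastforce
    \<comment> \<open>The choice of \<open>h\<close> balances the two sides: \<open>h\<^sup>2 M\<^sup>2 = h \<gamma> \<epsilon>\<close>.\<close>
    also have "h\<^sup>2 * M\<^sup>2 = h * (\<gamma> * \<epsilon>)"
      using M by (simp add: h_def power2_eq_square)
    finally have "real k * (h * (\<gamma> * \<epsilon>)) < 2 * \<Theta>0\<^sup>2" by (simp add: algebra_simps)
    also have "h * (\<gamma> * \<epsilon>) = \<gamma>\<^sup>2 * \<epsilon>\<^sup>2 / M\<^sup>2"
      by (simp add: h_def power2_eq_square)
    finally have "real k < 2 * \<Theta>0\<^sup>2 * M\<^sup>2 / (\<gamma>\<^sup>2 * \<epsilon>\<^sup>2)"
      using M assms(5,19) by (simp add: field_simps)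
    also have "\<dots> \<le> K"
    proof -
      have "1 \<le> (1 + 1 / \<gamma>)\<^sup>2" using assms(5) by (intro one_le_power) simp
      from mult_left_mono[OF this, of "2 * \<Theta>0\<^sup>2 * M\<^sup>2 / (\<gamma>\<^sup>2 * \<epsilon>\<^sup>2)"]
      show ?thesis by (simp add: K_def)
    qed
    finally show False using k(1) by simp
  qed
  have fin: "finite (x ` I)" by (simp add: I_def)
  have ne: "I \<noteq> {}" using good by blast
  have ex: "\<exists>xhat. is_arg_min f (\<lambda>z. z \<in> x ` I) xhat"
    using ex_is_arg_min_if_finite[OF fin, of f] ne by simp
  have "xhat \<in> Q \<and> f xhat - f xs \<le> \<epsilon> \<and> g xhat \<le> \<epsilon>"
    if "is_arg_min f (\<lambda>z. z \<in> x ` I) xhat" for xhat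
  proof -
    have "xhat \<in> x ` I" and le: "\<And>i. i \<in> I \<Longrightarrow> f xhat \<le> f (x i)"
      using that by (auto simp: is_arg_min_def not_less)
    moreover obtain i where "i \<in> I" "f (x i) - f xs \<le> \<epsilon>" using good by blast
    then have "f xhat - f xs \<le> \<epsilon>" using le[of i] by linarith
    ultimately show ?thesis using x_Q by (auto simp: I_def)
  qed
  then have "K \<le> real k \<and> (\<forall>j<k. \<not> K \<le> real j) \<and> int k \<le> \<lceil>K\<rceil> \<and>
      (let I = I in I \<noteq> {} \<and> (\<exists>xhat. is_arg_min f (\<lambda>z. z \<in> x ` I) xhat) \<and>
        (\<forall>xhat. is_arg_min f (\<lambda>z. z \<in> x ` I) xhat \<longrightarrow>
           xhat \<in> Q \<and> f xhat - f xs \<le> \<epsilon> \<and> g xhat \<le> \<epsilon>))"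
    using k ne ex by simp
  then show ?thesis unfolding I_def by (rule exI[of _ k])
qed

end
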